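(* Let $p\in\mathbb{N}$ and let the function $g\colon\mathbb{R}_+\to\mathbb{R}$ have the property that the sequence $n\mapsto\Delta^p g(n)$ (over positive integers $n$) converges to zero. Suppose that $f\colon\mathbb{R}_+\to\mathbb{R}$ is an eventually $p$-convex or eventually $p$-concave function satisfying the difference equation $\Delta f=g$ on $\mathbb{R}_+$. Then $f$ is uniquely determined (up to an additive constant) by $g$ through the equation $$f(x)=f(1)+\lim_{n\to\infty}f^p_n[g](x),\qquad x>0.$$
   Context: $\mathbb{N}=\{0,1,2,\ldots\}$, $\mathbb{N}^*=\{1,2,\ldots\}$, $\mathbb{R}_+=(0,\infty)$, and $\Delta f(x)=f(x+1)-f(x)$. For an integer $p\ge -1$, a function $f\colon I\to\mathbb{R}$ on a real interval $I$ with nonempty interior is $p$-convex (resp. $p$-concave) if for all $x_0<x_1<\cdots<x_{p+1}$ in $I$ the divided difference $f[x_0,\ldots,x_{p+1}]$ is $\ge 0$ (resp. $\le 0$), where $f[x_0,\ldots,x_n]=\sum_{k=0}^n f(x_k)/\prod_{j\ne k}(x_k-x_j)$ for pairwise distinct points. A function on $\mathbb{R}_+$ is eventually $p$-convex (resp. eventually $p$-concave) if it is so on some neighborhood $[a,\infty)$ of infinity. For $p\in\mathbb{N}$, $n\in\mathbb{N}^*$ and $g\colon\mathbb{R}_+\to\mathbb{R}$, $$f^p_n[g](x)=-g(x)+\sum_{k=1}^{n-1}(g(k)-g(x+k))+\sum_{j=1}^p\binom{x}{j}\Delta^{j-1}g(n),\qquad x>0.$$ *)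

theory Defs
  imports "HOL-Analysis.Analysis"
begin

text \<open>Functions on $(0,\infty)$ are total functions on the reals; every condition below only
  involves their values at positive arguments.\<close>

definition fwd_diff :: "(real \<Rightarrow> real) \<Rightarrow> real \<Rightarrow> real" where
  "fwd_diff f = (\<lambda>x. f (x + 1) - f x)"

text \<open>The divided difference of $f$ at $x_0,\ldots,x_n$; meaningful for pairwise distinct points.\<close>

definition divided_difference :: "(real \<Rightarrow> real) \<Rightarrow> nat \<Rightarrow> (nat \<Rightarrow> real) \<Rightarrow> real" where
  "divided_difference f n x = (\<Sum>k\<le>n. f (x k) / (\<Prod>j\<in>{..n} - {k}. x k - x j))"

text \<open>The order $p$ is an integer $\geq -1$; the points are $x_0 < \cdots < x_{p+1}$.
  $I$ is meant to be an interval with nonempty interior.\<close>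

definition p_convex_on :: "int \<Rightarrow> real set \<Rightarrow> (real \<Rightarrow> real) \<Rightarrow> bool" where
  "p_convex_on p I f \<longleftrightarrow>
     (\<forall>x. strict_mono_on {..nat (p + 1)} x \<and> x ` {..nat (p + 1)} \<subseteq> I \<longrightarrow>
          divided_difference f (nat (p + 1)) x \<ge> 0)"

definition p_concave_on :: "int \<Rightarrow> real set \<Rightarrow> (real \<Rightarrow> real) \<Rightarrow> bool" where
  "p_concave_on p I f \<longleftrightarrow>
     (\<forall>x. strict_mono_on {..nat (p + 1)} x \<and> x ` {..nat (p + 1)} \<subseteq> I \<longrightarrow>
          divided_difference f (nat (p + 1)) x \<le> 0)"

definition eventually_p_convex :: "int \<Rightarrow> (real \<Rightarrow> real) \<Rightarrow> bool" where
  "eventually_p_convex p f \<longleftrightarrow> (\<exists>a>0. p_convex_on p {a..} f)"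

definition eventually_p_concave :: "int \<Rightarrow> (real \<Rightarrow> real) \<Rightarrow> bool" where
  "eventually_p_concave p f \<longleftrightarrow> (\<exists>a>0. p_concave_on p {a..} f)"

text \<open>The function $f^p_n[g]$, for $n \geq 1$ and $x > 0$.\<close>

definition f_approx :: "nat \<Rightarrow> nat \<Rightarrow> (real \<Rightarrow> real) \<Rightarrow> real \<Rightarrow> real" where
  "f_approx p n g x =
     - g x + (\<Sum>k=1..<n. g (real k) - g (x + real k))
     + (\<Sum>j=1..p. (x gchoose j) * (fwd_diff ^^ (j - 1)) g (real n))"

end

theory Submission
  imports Defs
begin

text \<open>
  Since \<open>g = \<Delta>f\<close>, the sums in the approximating function telescope, and
  \<open>f(1) + f_approx p n g x\<close> turns out to be \<open>f(x)\<close> minus the error made at the point \<open>n + x\<close> when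
  \<open>f\<close> is replaced by its Newton interpolation polynomial at the nodes \<open>n, \<dots>, n + p\<close>.
  So everything reduces to showing that this error tends to zero (\<open>newton_error_tendsto_0\<close>);
  uniqueness follows, because the limit on the right-hand side depends on \<open>g\<close> only.

  By Newton's formula (\<open>newton_expansion\<close>) the error is
  \<open>x (x - 1) \<cdots> (x - p)\<close> times the divided difference of \<open>f\<close> at \<open>n, \<dots>, n + p, n + x\<close>.
  Suppose that \<open>f\<close> is eventually \<open>p\<close>-convex. For large \<open>n\<close> the divided difference is nonnegative,
  and \<open>x\<close> times it is a difference of two divided differences at \<open>p + 1\<close> nodes,
  namely at \<open>n + 1, \<dots>, n + p, n + x\<close> and at \<open>n, \<dots>, n + p\<close>.
  For a \<open>p\<close>-convex function, divided differences at \<open>p + 1\<close> nodes grow when the nodes move to the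
  right (\<open>set_divided_difference_le\<close>). Pushing the nodes of the first one beyond all of the old ones,
  to \<open>n + m, \<dots>, n + m + p\<close>, bounds \<open>x\<close> times the divided difference by
  \<open>(\<Delta>\<^sup>p f(n + m) - \<Delta>\<^sup>p f(n)) / p!\<close>, which is a sum of the \<open>m\<close> terms \<open>\<Delta>\<^sup>p g(n + i) / p!\<close>.
  Here \<open>m\<close> depends on \<open>x\<close> and \<open>p\<close> but not on \<open>n\<close>, so the bound tends to zero by hypothesis.
  The concave case follows by passing to \<open>-f\<close>.
\<close>

section \<open>Divided differences over finite sets\<close>

text \<open>Divided differences are symmetric in their nodes. Indexing them by the set of nodes builds
  this symmetry in, so that nodes can be added, removed and exchanged without any bookkeeping of
  positions.\<close>

definition set_divided_difference :: "(real \<Rightarrow> real) \<Rightarrow> real set \<Rightarrow> real" where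
  "set_divided_difference f S = (\<Sum>s\<in>S. f s / (\<Prod>t\<in>S - {s}. s - t))"

lemma divided_difference_eq_set:
  assumes "inj_on x {..n}"
  shows "divided_difference f n x = set_divided_difference f (x ` {..n})"
proof -
  have "(\<Prod>t\<in>x ` {..n} - {x k}. x k - t) = (\<Prod>j\<in>{..n} - {k}. x k - x j)" if "k \<le> n" for k
  proof -
    have "x ` {..n} - {x k} = x ` ({..n} - {k})"
      using assms that by (auto simp: inj_on_def)
    moreover have "inj_on x ({..n} - {k})"
      using assms by (rule inj_on_subset) auto
    ultimately show ?thesis
      by (simp add: prod.reindex)
  qed
  then show ?thesis
    unfolding divided_difference_def set_divided_difference_def
    using assms by (simp add: sum.reindex)
qed

lemma p_convex_on_set_divided_difference_nonneg:
  assumes "p_convex_on (int p) I f" "finite S" "S \<subseteq> I" "card S = p + 2"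
  shows "set_divided_difference f S \<ge> 0"
proof -
  define xs where "xs = sorted_list_of_set S"
  define x where "x = (\<lambda>i. xs ! i)"
  have len: "length xs = p + 2" and xs: "set xs = S" "sorted_wrt (<) xs"
    using assms by (auto simp: xs_def)
  have mono: "strict_mono_on {..p + 1} x"
    unfolding x_def using xs(2) len
    by (intro strict_mono_onI) (auto simp: sorted_wrt_iff_nth_less)
  have "{..p + 1} = {0..<length xs}"
    using len by auto
  then have img: "x ` {..p + 1} = S"
    using xs(1) by (simp add: x_def nth_image)
  have n: "nat (int p + 1) = p + 1"
    by simp
  have "divided_difference f (p + 1) x \<ge> 0"
    using assms(1,3) mono img unfolding p_convex_on_def n by blast
  then show ?thesis
    using mono img by (simp add: divided_difference_eq_set strict_mono_on_imp_inj_on)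
qed

text \<open>The basic recurrence. It is a termwise identity: at a common node \<open>s\<close> the two terms on the
  right have denominators that agree except for the factors \<open>s - b\<close> and \<open>s - a\<close>, and
  \<open>1 / (s - b) - 1 / (s - a) = (b - a) / ((s - a) (s - b))\<close>.\<close>

lemma set_divided_difference_exchange:
  assumes "finite T" "a \<notin> T" "b \<notin> T" "a \<noteq> b"
  shows "(b - a) * set_divided_difference f (insert a (insert b T))
       = set_divided_difference f (insert b T) - set_divided_difference f (insert a T)"
proof -
  define q where "q s = (\<Prod>t\<in>T - {s}. s - t)" for s
  have outer: "set_divided_difference f (insert c T) = f c / q c + (\<Sum>s\<in>T. f s / ((s - c) * q s))"
    if "c \<notin> T" for c
  proof -
    have "insert c T - {s} = insert c (T - {s})" if "s \<in> T" for s
      using that \<open>c \<notin> T\<close> by auto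
    then show ?thesis
      using that assms(1) by (simp add: set_divided_difference_def q_def)
  qed
  have "insert a (insert b T) - {s} = insert a (insert b (T - {s}))" if "s \<in> T" for s
    using that assms by auto
  moreover have "insert a (insert b T) - {b} = insert a T" "insert a (insert b T) - {a} = insert b T"
    using assms by auto
  ultimately have "set_divided_difference f (insert a (insert b T))
      = f a / ((a - b) * q a) + f b / ((b - a) * q b) + (\<Sum>s\<in>T. f s / ((s - a) * ((s - b) * q s)))"
    using assms by (simp add: set_divided_difference_def q_def)
  moreover have "(b - a) * (f a / ((a - b) * q a)) = - (f a / q a)"
    using assms(4) by (simp add: divide_simps) (simp add: algebra_simps)
  moreover have "(b - a) * (f b / ((b - a) * q b)) = f b / q b"
    using assms(4) by simp
  moreover have "(b - a) * (\<Sum>s\<in>T. f s / ((s - a) * ((s - b) * q s)))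
      = (\<Sum>s\<in>T. f s / ((s - b) * q s)) - (\<Sum>s\<in>T. f s / ((s - a) * q s))"
    unfolding sum_distrib_left sum_subtractf[symmetric]
  proof (intro sum.cong refl)
    fix s assume "s \<in> T"
    then have "s - a \<noteq> 0" "s - b \<noteq> 0" "q s \<noteq> 0"
      using assms by (auto simp: q_def)
    then show "(b - a) * (f s / ((s - a) * ((s - b) * q s)))
        = f s / ((s - b) * q s) - f s / ((s - a) * q s)"
      by (simp add: divide_simps) (simp add: algebra_simps)
  qed
  ultimately show ?thesis
    by (simp add: outer[OF assms(2)] outer[OF assms(3)] distrib_left)
qed

text \<open>The nodes are moved one at a time. By the recurrence, moving one node from \<open>a\<close> to \<open>b > a\<close>
  changes the divided difference by \<open>b - a\<close> times one with an additional node, which is nonnegative.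
  As all of \<open>A\<close> lies to the left of all of \<open>B\<close>, the nodes stay distinct on the way. The set \<open>C\<close> of
  nodes that do not move makes the induction work; it absorbs those still waiting to be moved.\<close>

lemma set_divided_difference_le:
  assumes conv: "p_convex_on (int p) I f"
    and "finite A" "finite B" "finite C" "card A = card B" "card A + card C = p + 1"
    and "\<And>a b. a \<in> A \<Longrightarrow> b \<in> B \<Longrightarrow> a < b" "A \<inter> C = {}" "B \<inter> C = {}"
    and "A \<subseteq> I" "B \<subseteq> I" "C \<subseteq> I"
  shows "set_divided_difference f (A \<union> C) \<le> set_divided_difference f (B \<union> C)"
  using assms(2-)
proof (induction A arbitrary: B C rule: finite_induct)
  case empty
  then show ?case by simp
next
  case (insert a A)
  then have "card B = Suc (card A)"
    by simp
  then obtain b B' where B: "B = insert b B'" "b \<notin> B'" "card B' = card A" "finite B'"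
    by (metis card_Suc_eq insert.prems(1) finite_insert)
  have "a < b"
    using insert.prems(5) B(1) by blast
  have "a \<notin> B"
    using insert.prems(5) by blast
  have "set_divided_difference f (A \<union> insert a C) \<le> set_divided_difference f (B' \<union> insert a C)"
    by (rule insert.IH) (use insert.prems insert.hyps B \<open>a \<notin> B\<close> in auto)
  moreover have "set_divided_difference f (insert a (B' \<union> C)) \<le> set_divided_difference f (insert b (B' \<union> C))"
  proof -
    have disj: "a \<notin> B' \<union> C" "b \<notin> B' \<union> C" "B' \<inter> C = {}"
      using insert.prems B \<open>a \<notin> B\<close> by auto
    have fin: "finite (B' \<union> C)"
      using B insert.prems by simp
    have "card (B' \<union> C) = p"
      using B insert.prems insert.hyps disj(3) by (simp add: card_Un_disjoint)
    then have "card (insert a (insert b (B' \<union> C))) = p + 2"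
      using disj fin \<open>a < b\<close> by simp
    then have "set_divided_difference f (insert a (insert b (B' \<union> C))) \<ge> 0"
      using insert.prems B fin
      by (intro p_convex_on_set_divided_difference_nonneg[OF conv]) auto
    then have "(b - a) * set_divided_difference f (insert a (insert b (B' \<union> C))) \<ge> 0"
      using \<open>a < b\<close> by simp
    then show ?thesis
      using set_divided_difference_exchange[OF fin disj(1,2), of f] \<open>a < b\<close> by simp
  qed
  ultimately show ?case
    by (simp add: B(1))
qed


section \<open>Newton's formula at equally spaced nodes\<close>

lemma funpow_Suc_fwd_diff:
  "(fwd_diff ^^ Suc j) f x = (fwd_diff ^^ j) f (x + 1) - (fwd_diff ^^ j) f x"
  by (simp only: funpow.simps comp_apply fwd_diff_def)

definition nodes :: "real \<Rightarrow> nat \<Rightarrow> real set" where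
  "nodes y k = (\<lambda>i. y + real i) ` {..<k}"

lemma finite_nodes [simp]: "finite (nodes y k)"
  by (simp add: nodes_def)

lemma card_nodes [simp]: "card (nodes y k) = k"
  by (simp add: nodes_def card_image inj_on_def)

lemma nodes_Suc: "nodes y (Suc k) = insert (y + real k) (nodes y k)"
  by (auto simp: nodes_def lessThan_Suc)

lemma nodes_Suc_first: "nodes y (Suc k) = insert y (nodes (y + 1) k)"
  by (simp add: nodes_def lessThan_Suc_eq_insert_0 image_image add.assoc)

lemma mem_nodes_iff: "y + x \<in> nodes y k \<longleftrightarrow> (\<exists>i<k. x = real i)"
  by (auto simp: nodes_def)

lemma nodes_gt: "z < y \<Longrightarrow> t \<in> nodes y k \<Longrightarrow> z < t"
  by (auto simp: nodes_def)

lemma set_divided_difference_nodes: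
  "set_divided_difference f (nodes y (Suc k)) = (fwd_diff ^^ k) f y / fact k"
proof (induction k arbitrary: y)
  case 0
  then show ?case
    by (simp add: nodes_def lessThan_Suc set_divided_difference_def)
next
  case (Suc k)
  let ?T = "nodes (y + 1) k"
  have last: "nodes (y + 1) (Suc k) = insert (y + real (Suc k)) ?T"
    by (simp add: nodes_Suc add.assoc)
  have "y \<notin> ?T"
    using nodes_gt[of y "y + 1" y k] by auto
  moreover have "y + real (Suc k) \<notin> ?T"
    by (auto simp: nodes_def)
  ultimately have "real (Suc k) * set_divided_difference f (nodes y (Suc (Suc k)))
      = set_divided_difference f (nodes (y + 1) (Suc k)) - set_divided_difference f (nodes y (Suc k))"
    using set_divided_difference_exchange[of ?T y "y + real (Suc k)" f]
    by (simp add: last nodes_Suc_first[of y] del: of_nat_Suc)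
  also have "\<dots> = (fwd_diff ^^ Suc k) f y / fact k"
    by (simp only: Suc.IH funpow_Suc_fwd_diff diff_divide_distrib)
  finally show ?case
    by (simp add: field_simps del: of_nat_Suc funpow.simps)
qed

text \<open>Adding the node \<open>y + k\<close> splits the next term off the remainder; this is the recurrence for
  divided differences, multiplied by \<open>x (x - 1) \<cdots> (x - k + 1)\<close>.\<close>

lemma newton_expansion:
  assumes "\<And>i. i < k \<Longrightarrow> x \<noteq> real i"
  shows "f (y + x) = (\<Sum>j<k. (x gchoose j) * (fwd_diff ^^ j) f y)
       + (\<Prod>i<k. x - real i) * set_divided_difference f (insert (y + x) (nodes y k))"
  using assms
proof (induction k)
  case 0
  then show ?case
    by (simp add: nodes_def set_divided_difference_def)
next
  case (Suc k)
  have "y + x \<notin> nodes y k" "y + real k \<noteq> y + x"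
    using Suc.prems by (auto simp: mem_nodes_iff)
  moreover have "y + real k \<notin> nodes y k"
    by (auto simp: mem_nodes_iff)
  ultimately have "set_divided_difference f (insert (y + x) (nodes y k))
      = (x - real k) * set_divided_difference f (insert (y + x) (nodes y (Suc k)))
        + (fwd_diff ^^ k) f y / fact k"
    using set_divided_difference_exchange[of "nodes y k" "y + real k" "y + x" f]
    by (simp add: nodes_Suc insert_commute flip: set_divided_difference_nodes)
  moreover have "(\<Prod>i<k. x - real i) * ((fwd_diff ^^ k) f y / fact k)
      = (x gchoose k) * (fwd_diff ^^ k) f y"
    by (simp add: gbinomial_prod_rev atLeast0LessThan)
  ultimately show ?case
    using Suc by (simp add: distrib_left mult.assoc)
qed

text \<open>At an interpolation node the expansion is exact. The formula with remainder still applies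
  when it is stopped just before that node; its remainder is then the last nonzero term.\<close>

lemma newton_expansion_node:
  assumes "i \<le> p"
  shows "f (y + real i) = (\<Sum>j\<le>p. (real i gchoose j) * (fwd_diff ^^ j) f y)"
proof -
  have "(\<Prod>l<i. real i - real l) = fact i"
    using gbinomial_prod_rev[of "real i" i]
    by (simp add: atLeast0LessThan flip: binomial_gbinomial)
  then have "f (y + real i)
      = (\<Sum>j<i. (real i gchoose j) * (fwd_diff ^^ j) f y) + (fwd_diff ^^ i) f y"
    using newton_expansion[of i "real i" f y] set_divided_difference_nodes[of f y i]
    by (simp add: nodes_Suc)
  also have "\<dots> = (\<Sum>j\<le>i. (real i gchoose j) * (fwd_diff ^^ j) f y)"
    by (simp add: lessThan_Suc flip: lessThan_Suc_atMost binomial_gbinomial)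
  also have "\<dots> = (\<Sum>j\<le>p. (real i gchoose j) * (fwd_diff ^^ j) f y)"
    using assms by (intro sum.mono_neutral_left) (auto simp flip: binomial_gbinomial)
  finally show ?thesis .
qed


section \<open>The interpolation error of eventually convex functions\<close>

definition newton_error :: "nat \<Rightarrow> (real \<Rightarrow> real) \<Rightarrow> real \<Rightarrow> real \<Rightarrow> real" where
  "newton_error p f y x = f (y + x) - (\<Sum>j\<le>p. (x gchoose j) * (fwd_diff ^^ j) f y)"

text \<open>The first factor \<open>x\<close> of \<open>x (x - 1) \<cdots> (x - p)\<close> turns the divided difference at \<open>p + 2\<close> nodes
  into a difference of two at \<open>p + 1\<close> nodes. The condition on \<open>m\<close> ensures that the shifted nodes
  \<open>y + m, \<dots>, y + m + p\<close> lie to the right of all the others.\<close>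

lemma abs_newton_error_le:
  assumes conv: "p_convex_on (int p) {a..} f" and "a \<le> y" "x > 0" "p < m" "x < real m"
  shows "\<bar>newton_error p f y x\<bar> \<le> (\<Prod>i<p. \<bar>x - real (Suc i)\<bar>) / fact p
           * ((fwd_diff ^^ p) f (y + real m) - (fwd_diff ^^ p) f y)"
    (is "_ \<le> ?c / fact p * ?d")
proof (cases "\<exists>i\<le>p. x = real i")
  case True
  then obtain i where "i \<le> p" "x = real i"
    by blast
  then have "i > 0" "newton_error p f y x = 0"
    using assms(3) newton_expansion_node[of i p f y] by (auto simp: newton_error_def)
  moreover have "?c = 0"
    using \<open>i > 0\<close> \<open>i \<le> p\<close> \<open>x = real i\<close>
    by (intro prod_zero) (auto intro!: bexI[of _ "i - 1"])
  ultimately show ?thesis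
    by (simp only:)
next
  case False
  let ?T = "nodes (y + 1) p"
  define D where "D = set_divided_difference f (insert (y + x) (nodes y (Suc p)))"
  have notin: "y + x \<notin> nodes y (Suc p)"
    using False by (auto simp: mem_nodes_iff less_Suc_eq_le)
  then have T: "y \<notin> ?T" "y + x \<notin> ?T"
    using nodes_gt[of y "y + 1" y p] by (auto simp: nodes_Suc_first)
  have ge: "nodes z k \<subseteq> {a..}" if "a \<le> z" for z k
    using that by (auto simp: nodes_def)
  have "D \<ge> 0"
    unfolding D_def using notin assms ge[of y "Suc p"]
    by (intro p_convex_on_set_divided_difference_nonneg[OF conv]) auto
  have "x * D = set_divided_difference f (insert (y + x) ?T)
      - set_divided_difference f (nodes y (Suc p))"
    using set_divided_difference_exchange[of ?T y "y + x" f] T assms(3)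
    by (simp add: D_def nodes_Suc_first insert_commute)
  also have "set_divided_difference f (insert (y + x) ?T)
      \<le> set_divided_difference f (nodes (y + real m) (Suc p))"
  proof -
    have "s < t" if "s \<in> insert (y + x) ?T" "t \<in> nodes (y + real m) (Suc p)" for s t
    proof -
      have "s < y + real m"
        using that(1) assms by (auto simp: nodes_def)
      then show ?thesis
        using that(2) by (rule nodes_gt)
    qed
    then show ?thesis
      using set_divided_difference_le[OF conv, of "insert (y + x) ?T" "nodes (y + real m) (Suc p)" "{}"]
        T assms ge[of "y + 1" p] ge[of "y + real m" "Suc p"] by simp
  qed
  finally have xD: "x * D \<le> ?d / fact p"
    by (simp add: set_divided_difference_nodes diff_divide_distrib)
  have "newton_error p f y x = (\<Prod>i<Suc p. x - real i) * D"
    using newton_expansion[of "Suc p" x f y] False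
    by (simp add: newton_error_def D_def lessThan_Suc_atMost less_Suc_eq_le)
  also have "\<dots> = (\<Prod>i<p. x - real (Suc i)) * (x * D)"
    by (simp only: prod.lessThan_Suc_shift) simp
  finally have "\<bar>newton_error p f y x\<bar> = ?c * (x * D)"
    using \<open>D \<ge> 0\<close> assms(3) by (simp add: abs_mult abs_prod)
  also have "\<dots> \<le> ?c * (?d / fact p)"
    using xD by (intro mult_left_mono prod_nonneg) auto
  finally show ?thesis
    by simp
qed

lemma funpow_fwd_diff_uminus: "(fwd_diff ^^ j) (\<lambda>x. - f x) = (\<lambda>x. - (fwd_diff ^^ j) f x)"
  by (induction j) (simp_all add: fun_eq_iff funpow_Suc_fwd_diff del: funpow.simps)

lemma p_convex_on_uminus: "p_convex_on p I (\<lambda>x. - f x) \<longleftrightarrow> p_concave_on p I f"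
  by (simp add: p_convex_on_def p_concave_on_def divided_difference_def sum_negf)

lemma newton_error_uminus: "newton_error p (\<lambda>x. - f x) y x = - newton_error p f y x"
  by (simp add: newton_error_def funpow_fwd_diff_uminus sum_negf)

lemma newton_error_tendsto_0:
  assumes f: "eventually_p_convex (int p) f \<or> eventually_p_concave (int p) f"
    and lim: "(\<lambda>n. (fwd_diff ^^ Suc p) f (real n)) \<longlonglongrightarrow> 0" and "x > 0"
  shows "(\<lambda>n. newton_error p f (real n) x) \<longlonglongrightarrow> 0"
proof -
  have convex: "(\<lambda>n. newton_error p f (real n) x) \<longlonglongrightarrow> 0"
    if f: "eventually_p_convex (int p) f"
      and lim: "(\<lambda>n. (fwd_diff ^^ Suc p) f (real n)) \<longlonglongrightarrow> 0" for f
  proof -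
    obtain a where a: "p_convex_on (int p) {a..} f"
      using f by (auto simp: eventually_p_convex_def)
    obtain m0 where "max x (real p) < real m0"
      using reals_Archimedean2 by blast
    then obtain m where m: "p < m" "x < real m"
      by auto
    define c where "c = (\<Prod>i<p. \<bar>x - real (Suc i)\<bar>) / fact p"
    have telescope: "(fwd_diff ^^ p) f (real n + real k) - (fwd_diff ^^ p) f (real n)
        = (\<Sum>i<k. (fwd_diff ^^ Suc p) f (real (n + i)))" for n k
      by (induction k) (simp_all add: funpow_Suc_fwd_diff add_ac del: funpow.simps)
    have "(\<lambda>n. \<Sum>i<m. (fwd_diff ^^ Suc p) f (real (n + i))) \<longlonglongrightarrow> 0"
      by (intro tendsto_null_sum LIMSEQ_ignore_initial_segment[OF lim])
    then have lim_bound: "(\<lambda>n. c * (\<Sum>i<m. (fwd_diff ^^ Suc p) f (real (n + i)))) \<longlonglongrightarrow> 0"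
      by (rule tendsto_mult_right_zero)
    have "\<forall>\<^sub>F n in sequentially. norm (newton_error p f (real n) x)
        \<le> c * (\<Sum>i<m. (fwd_diff ^^ Suc p) f (real (n + i)))"
      using eventually_ge_at_top[of "nat \<lceil>a\<rceil>"]
    proof eventually_elim
      case (elim n)
      then have "a \<le> real n"
        by linarith
      then show ?case
        using abs_newton_error_le[OF a _ \<open>x > 0\<close> m, of "real n"]
        by (simp only: telescope c_def real_norm_def)
    qed
    then show ?thesis
      using lim_bound by (rule Lim_null_comparison)
  qed
  from f show ?thesis
  proof
    assume "eventually_p_convex (int p) f"
    then show ?thesis
      using lim by (rule convex)
  next
    assume "eventually_p_concave (int p) f"
    then have "eventually_p_convex (int p) (\<lambda>x. - f x)"
      by (simp add: eventually_p_convex_def eventually_p_concave_def p_convex_on_uminus)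
    moreover have "(\<lambda>n. (fwd_diff ^^ Suc p) (\<lambda>x. - f x) (real n)) \<longlonglongrightarrow> 0"
      using tendsto_minus[OF lim] by (simp only: funpow_fwd_diff_uminus minus_zero)
    ultimately have "(\<lambda>n. newton_error p (\<lambda>x. - f x) (real n) x) \<longlonglongrightarrow> 0"
      by (rule convex)
    from tendsto_minus[OF this] show ?thesis
      by (simp add: newton_error_uminus)
  qed
qed


section \<open>Solutions of the difference equation\<close>

text \<open>The difference equation holds at positive arguments only; these are never left by forward
  shifts.\<close>

lemma funpow_fwd_diff_cong:
  assumes "\<forall>x>0. u x = v x" "x > 0"
  shows "(fwd_diff ^^ j) u x = (fwd_diff ^^ j) v x"
  using assms(2)
proof (induction j arbitrary: x)
  case 0
  then show ?case using assms(1) by simp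
next
  case (Suc j)
  then show ?case by (simp add: funpow_Suc_fwd_diff del: funpow.simps)
qed

lemma funpow_Suc_fwd_diff_solution:
  assumes "\<forall>x>0. fwd_diff f x = g x" "x > 0"
  shows "(fwd_diff ^^ Suc j) f x = (fwd_diff ^^ j) g x"
  using funpow_fwd_diff_cong[OF assms] by (simp add: funpow_Suc_right del: funpow.simps)

lemma f_approx_eq_newton_error:
  assumes "\<forall>x>0. fwd_diff f x = g x" "x > 0" "n > 0"
  shows "f_approx p n g x = f x - f 1 - newton_error p f (real n) x"
proof -
  have g: "g z = f (z + 1) - f z" if "z > 0" for z
    using assms(1) that by (simp add: fwd_diff_def)
  have "- g x + (\<Sum>k=1..<n. g (real k) - g (x + real k)) = f x - f (real n + x) + f (real n) - f 1"
    using \<open>n > 0\<close>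
  proof (induction n rule: nat_induct_non_zero)
    case 1
    then show ?case using g[OF assms(2)] by (simp add: add.commute)
  next
    case (Suc n)
    have "g (real n) = f (real n + 1) - f (real n)" "g (x + real n) = f (x + real n + 1) - f (x + real n)"
      using Suc.hyps assms(2) by (auto intro!: g)
    then show ?case
      using Suc by (simp add: add.commute add.left_commute)
  qed
  moreover have "(\<Sum>j=1..p. (x gchoose j) * (fwd_diff ^^ (j - 1)) g (real n))
      = (\<Sum>j=1..p. (x gchoose j) * (fwd_diff ^^ j) f (real n))"
  proof (intro sum.cong refl)
    fix j assume "j \<in> {1..p}"
    then show "(x gchoose j) * (fwd_diff ^^ (j - 1)) g (real n) = (x gchoose j) * (fwd_diff ^^ j) f (real n)"
      using funpow_Suc_fwd_diff_solution[OF assms(1), of "real n" "j - 1"] \<open>n > 0\<close>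
      by (simp del: funpow.simps)
  qed
  moreover have "(\<Sum>j\<le>p. (x gchoose j) * (fwd_diff ^^ j) f (real n))
      = f (real n) + (\<Sum>j=1..p. (x gchoose j) * (fwd_diff ^^ j) f (real n))"
    by (simp add: atMost_atLeast0 sum.atLeast_Suc_atMost)
  ultimately show ?thesis
    by (simp add: f_approx_def newton_error_def)
qed

lemma f_approx_tendsto:
  assumes g: "(\<lambda>n. (fwd_diff ^^ p) g (real n)) \<longlonglongrightarrow> 0"
    and f: "eventually_p_convex (int p) f \<or> eventually_p_concave (int p) f"
    and eq: "\<forall>x>0. fwd_diff f x = g x" and "x > 0"
  shows "(\<lambda>n. f_approx p n g x) \<longlonglongrightarrow> f x - f 1"
proof -
  have "\<forall>\<^sub>F n in sequentially. (fwd_diff ^^ p) g (real n) = (fwd_diff ^^ Suc p) f (real n)"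
    using eventually_gt_at_top[of 0]
    by eventually_elim (simp add: funpow_Suc_fwd_diff_solution[OF eq] del: funpow.simps)
  then have "(\<lambda>n. (fwd_diff ^^ Suc p) f (real n)) \<longlonglongrightarrow> 0"
    by (rule Lim_transform_eventually[OF g])
  then have "(\<lambda>n. f x - f 1 - newton_error p f (real n) x) \<longlonglongrightarrow> f x - f 1 - 0"
    by (intro tendsto_intros newton_error_tendsto_0 f \<open>x > 0\<close>)
  moreover have "\<forall>\<^sub>F n in sequentially. f x - f 1 - newton_error p f (real n) x = f_approx p n g x"
    using eventually_gt_at_top[of 0]
    by eventually_elim (simp add: f_approx_eq_newton_error[OF eq \<open>x > 0\<close>])
  ultimately show ?thesis
    by (simp add: Lim_transform_eventually)
qed

theorem theorem1p5:
  fixes p :: nat and f g :: "real \<Rightarrow> real"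
  assumes g: "(\<lambda>n::nat. (fwd_diff ^^ p) g (real n)) \<longlonglongrightarrow> 0"
    and f_conv: "eventually_p_convex (int p) f \<or> eventually_p_concave (int p) f"
    and f_eq: "\<forall>x>0. fwd_diff f x = g x"
  shows "(\<forall>x>0. convergent (\<lambda>n. f_approx p n g x) \<and>
                f x = f 1 + lim (\<lambda>n. f_approx p n g x)) \<and>
         (\<forall>h :: real \<Rightarrow> real.
            (eventually_p_convex (int p) h \<or> eventually_p_concave (int p) h) \<and>
            (\<forall>x>0. fwd_diff h x = g x) \<longrightarrow>
            (\<exists>c. \<forall>x>0. h x = f x + c))"
proof (intro conjI allI impI)
  fix x :: real assume "x > 0"
  note lim = f_approx_tendsto[OF g f_conv f_eq this]
  show "convergent (\<lambda>n. f_approx p n g x)"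
    using lim by (rule convergentI)
  show "f x = f 1 + lim (\<lambda>n. f_approx p n g x)"
    using limI[OF lim] by simp
next
  fix h :: "real \<Rightarrow> real"
  assume h: "(eventually_p_convex (int p) h \<or> eventually_p_concave (int p) h) \<and>
    (\<forall>x>0. fwd_diff h x = g x)"
  have "h x = f x + (h 1 - f 1)" if "x > 0" for x
  proof -
    have "(\<lambda>n. f_approx p n g x) \<longlonglongrightarrow> h x - h 1"
      using f_approx_tendsto[OF g conjunct1[OF h] conjunct2[OF h] that] .
    then have "h x - h 1 = f x - f 1"
      using f_approx_tendsto[OF g f_conv f_eq that] by (rule LIMSEQ_unique)
    then show ?thesis by simp
  qed
  then show "\<exists>c. \<forall>x>0. h x = f x + c" by blast
qed

end
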